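(* A spectral measure over $\mathbb{T}^2$ of the graph $\mathcal{E}^{(8)}$ (with its distinguished vertex $\ast$) is $$\mathrm{d}\varepsilon=\frac{2-\sqrt2}{8}\,\mathrm{d}^{((8))}+\frac{2+\sqrt2}{8}\,\mathrm{d}^{((8/3))}+\frac12\,\mathrm{d}^{(24/5,1/12)}.$$ That is, $\int_{\mathbb{T}^2}R_{m,n}\,\mathrm{d}\varepsilon=\langle \Delta^m(\Delta^{\ast})^{n}e_{\ast},e_{\ast}\rangle$ for all integers $m,n\ge 0$, where $\Delta$ is the adjacency matrix of $\mathcal{E}^{(8)}$.
   Context: $\mathbb{T}$ is the unit circle in $\mathbb{C}$. For integers $m,n\ge0$ put $R_{m,n}(\omega_1,\omega_2)=(\omega_1+\omega_2^{-1}+\omega_1^{-1}\omega_2)^m(\omega_1^{-1}+\omega_2+\omega_1\omega_2^{-1})^{n}$. For a finite directed graph with normal adjacency matrix $\Delta$ (entry $\Delta_{v,w}$ = number of edges from $v$ to $w$) and a vertex $v$, a measure $\varepsilon$ on $\mathbb{T}^2$ is called a spectral measure over $\mathbb{T}^2$ at $v$ if $\int_{\mathbb{T}^2} R_{m,n}\,\mathrm{d}\varepsilon=\langle\Delta^m(\Delta^{\ast})^{n}e_v,e_v\rangle$ for all $m,n\ge0$, with $e_v$ the basis vector of $v$. The group $S_3$ acts on $\mathbb{T}^2$, generated by $(\omega_1,\omega_2)\mapsto(\omega_2^{-1},\omega_1^{-1})$ and $(\omega_1,\omega_2)\mapsto(\omega_2^{-1},\omega_1\omega_2^{-1})$. Let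 $\omega=e^{2\pi i/3}$ and, for rational $s\ge2$, $\tau=e^{2\pi i/s}$. Then $\mathrm{d}^{((s))}$ is the uniform probability measure on the union of the $S_3$-orbits of $(\tau,\tau)$, $(\overline{\omega}\,\overline{\tau},\omega)$, $(\omega,\overline{\omega}\,\overline{\tau})$; and for rational $s>2$, $0\le k\le 1/s$, $\mathrm{d}^{(s,k)}$ is the uniform probability measure on the union of the $S_3$-orbits of $(\tau e^{2\pi ik},\tau)$, $(\tau,\tau e^{2\pi ik})$, $(\overline{\omega}\,\overline{\tau},\omega e^{2\pi ik})$, $(\omega e^{2\pi ik},\overline{\omega}\,\overline{\tau})$, $(\overline{\omega}\,\overline{\tau}e^{-2\pi ik},\omega e^{-2\pi ik})$, $(\omega e^{-2\pi ik},\overline{\omega}\,\overline{\tau}e^{-2\pi ik})$. The graph $\mathcal{E}^{(8)}$ (the nimrep graph of the conformal inclusion $SU(3)_5\subset SU(6)_1$) has 12 vertices $o_r,p_r$, $r\in\mathbb{Z}/6$, and the (single) edges $o_r\to p_r$, $p_r\to p_{r+1}$, $p_r\to p_{r-2}$, $p_r\to o_{r-1}$ for all $r\in\mathbb{Z}/6$. The distinguished vertex is $\ast=o_0$ (a vertex of lowest Perron-Frobenius weight). *)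

theory Defs
  imports
    "HOL-Probability.Probability"
    "HOL-Algebra.Bij"
    "HOL-Algebra.Generated_Groups"
    "HOL-Algebra.Group_Action"
    "Graph_Theory.Digraph"
begin

subsection \<open>The torus and the functions \<open>R\<close>\<close>

definition torus :: "(complex \<times> complex) set" where
  "torus = sphere 0 1 \<times> sphere 0 1"

definition torus_borel :: "(complex \<times> complex) measure" where
  "torus_borel = restrict_space borel torus"

definition R :: "nat \<Rightarrow> nat \<Rightarrow> complex \<times> complex \<Rightarrow> complex" where
  "R m n = (\<lambda>(w1, w2).
     (w1 + inverse w2 + inverse w1 * w2) ^ m * (inverse w1 + w2 + w1 * inverse w2) ^ n)"


subsection \<open>Adjacency matrices and spectral measures\<close>

definition adjacency_matrix :: "('v::finite, 'e) pre_digraph \<Rightarrow> complex ^ 'v ^ 'v" where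
  "adjacency_matrix G = (\<chi> v w. of_nat (card {e \<in> arcs G. tail G e = v \<and> head G e = w}))"

definition adjoint_matrix :: "complex ^ 'v ^ 'v \<Rightarrow> complex ^ 'v ^ 'v" where
  "adjoint_matrix A = (\<chi> v w. cnj (A $ w $ v))"

definition matrix_power :: "complex ^ 'v ^ 'v \<Rightarrow> nat \<Rightarrow> complex ^ 'v ^ 'v" where
  "matrix_power A n = (((**) A) ^^ n) (mat 1)"

text \<open>The complex (sesquilinear) inner product; the library's \<open>\<bullet>\<close> on \<open>complex ^ 'v\<close> is its
  real part.\<close>

definition hermitian_inner :: "complex ^ 'v \<Rightarrow> complex ^ 'v \<Rightarrow> complex" where
  "hermitian_inner x y = (\<Sum>v\<in>UNIV. x $ v * cnj (y $ v))"

text \<open>The vertex set of \<open>G\<close> is the whole finite type \<open>'v\<close>, which indexes the matrix. Integrability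
  is required explicitly because the Bochner integral of a non-integrable function is \<open>0\<close>.\<close>

definition is_spectral_measure ::
    "('v::finite, 'e) pre_digraph \<Rightarrow> 'v \<Rightarrow> (complex \<times> complex) measure \<Rightarrow> bool" where
  "is_spectral_measure G v \<epsilon> \<longleftrightarrow>
     fin_digraph G \<and> verts G = UNIV \<and>
     (let D = adjacency_matrix G in
        D ** adjoint_matrix D = adjoint_matrix D ** D \<and>
        space \<epsilon> = torus \<and> sets \<epsilon> = sets torus_borel \<and>
        (\<forall>m n. integrable \<epsilon> (R m n) \<and>
           (\<integral>x. R m n x \<partial>\<epsilon>) =
             hermitian_inner
               ((matrix_power D m ** matrix_power (adjoint_matrix D) n) *v axis v 1)
               (axis v 1)))"


subsection \<open>The action of \<open>S\<^sub>3\<close>\<close>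

definition torus_flip :: "complex \<times> complex \<Rightarrow> complex \<times> complex" where
  "torus_flip = (\<lambda>(w1, w2) \<in> torus. (inverse w2, inverse w1))"

definition torus_rot :: "complex \<times> complex \<Rightarrow> complex \<times> complex" where
  "torus_rot = (\<lambda>(w1, w2) \<in> torus. (inverse w2, w1 * inverse w2))"

definition torus_S3 :: "(complex \<times> complex \<Rightarrow> complex \<times> complex) monoid" where
  "torus_S3 = subgroup_generated (BijGroup torus) {torus_flip, torus_rot}"

definition S3_orbit :: "complex \<times> complex \<Rightarrow> (complex \<times> complex) set" where
  "S3_orbit = orbit torus_S3 (\<lambda>g. g)"


subsection \<open>The measures\<close>

definition uniform_on :: "(complex \<times> complex) set \<Rightarrow> (complex \<times> complex) measure" where
  "uniform_on S = distr (uniform_count_measure S) torus_borel (\<lambda>x. x)"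

abbreviation expi :: "real \<Rightarrow> complex" where
  "expi x \<equiv> exp (2 * of_real pi * \<i> * of_real x)"

abbreviation \<omega> :: complex where
  "\<omega> \<equiv> expi (1 / 3)"

abbreviation \<tau> :: "rat \<Rightarrow> complex" where
  "\<tau> s \<equiv> expi (1 / of_rat s)"

text \<open>\<open>d_diag s\<close> is the measure written d with superscript ((s)); it is meant for \<open>s \<ge> 2\<close>.
  \<open>d_pair s k\<close> is the measure written d with superscript (s,k); it is meant for \<open>s > 2\<close> and
  \<open>0 \<le> k \<le> 1/s\<close>.\<close>

definition d_diag_points :: "rat \<Rightarrow> (complex \<times> complex) set" where
  "d_diag_points s =
     S3_orbit (\<tau> s, \<tau> s) \<union>
     S3_orbit (cnj \<omega> * cnj (\<tau> s), \<omega>) \<union>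
     S3_orbit (\<omega>, cnj \<omega> * cnj (\<tau> s))"

definition d_diag :: "rat \<Rightarrow> (complex \<times> complex) measure" where
  "d_diag s = uniform_on (d_diag_points s)"

definition d_pair_points :: "rat \<Rightarrow> real \<Rightarrow> (complex \<times> complex) set" where
  "d_pair_points s k =
     S3_orbit (\<tau> s * expi k, \<tau> s) \<union>
     S3_orbit (\<tau> s, \<tau> s * expi k) \<union>
     S3_orbit (cnj \<omega> * cnj (\<tau> s), \<omega> * expi k) \<union>
     S3_orbit (\<omega> * expi k, cnj \<omega> * cnj (\<tau> s)) \<union>
     S3_orbit (cnj \<omega> * cnj (\<tau> s) * expi (- k), \<omega> * expi (- k)) \<union>
     S3_orbit (\<omega> * expi (- k), cnj \<omega> * cnj (\<tau> s) * expi (- k))"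

definition d_pair :: "rat \<Rightarrow> real \<Rightarrow> (complex \<times> complex) measure" where
  "d_pair s k = uniform_on (d_pair_points s k)"

text \<open>The sum of two measures on the same \<open>\<sigma>\<close>-algebra.\<close>

definition add_measure :: "'a measure \<Rightarrow> 'a measure \<Rightarrow> 'a measure" where
  "add_measure M N = measure_of (space M) (sets M) (\<lambda>A. emeasure M A + emeasure N A)"


subsection \<open>The graph \<open>\<E>\<^sup>(\<^sup>8\<^sup>)\<close>\<close>

text \<open>The numeral type \<open>6\<close> is the ring of integers modulo 6.\<close>

datatype e8_vertex = Vo "6" | Vp "6"

lemma UNIV_e8_vertex: "(UNIV :: e8_vertex set) = range Vo \<union> range Vp"
  by (auto intro: e8_vertex.exhaust)

instance e8_vertex :: finite
  by standard (simp add: UNIV_e8_vertex)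

definition E8_arcs :: "(e8_vertex \<times> e8_vertex) set" where
  "E8_arcs = (\<Union>r. {(Vo r, Vp r), (Vp r, Vp (r + 1)), (Vp r, Vp (r - 2)), (Vp r, Vo (r - 1))})"

definition E8 :: "(e8_vertex, e8_vertex \<times> e8_vertex) pre_digraph" where
  "E8 = \<lparr>verts = UNIV, arcs = E8_arcs, tail = fst, head = snd\<rparr>"


subsection \<open>Well-definedness\<close>

lemma space_torus_borel [simp]: "space torus_borel = torus"
  by (simp add: torus_borel_def space_restrict_space)

lemma card_e8_vertex: "card (UNIV :: e8_vertex set) = 12"
proof -
  have "card (range Vo \<union> range Vp) = card (range Vo) + card (range Vp)"
    by (rule card_Un_disjoint) auto
  also have "card (range Vo) = CARD(6)" by (rule card_image) (auto intro: injI)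
  also have "card (range Vp) = CARD(6)" by (rule card_image) (auto intro: injI)
  finally show ?thesis by (simp add: UNIV_e8_vertex)
qed

lemma fin_digraph_E8: "fin_digraph E8"
  by unfold_locales (auto simp: E8_def)

lemma space_add_measure [simp]: "space (add_measure M N) = space M"
  and sets_add_measure [simp]: "sets (add_measure M N) = sets M"
  by (simp_all add: add_measure_def)

lemma emeasure_add_measure:
  assumes "sets M = sets N" "A \<in> sets M"
  shows "emeasure (add_measure M N) A = emeasure M A + emeasure N A"
proof (rule emeasure_measure_of[OF add_measure_def])
  show "countably_additive (sets (add_measure M N)) (\<lambda>A. emeasure M A + emeasure N A)"
  proof (rule countably_additiveI)
    fix F :: "nat \<Rightarrow> _" assume F: "range F \<subseteq> sets (add_measure M N)" "disjoint_family F"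
    have "(\<Sum>i. emeasure M (F i) + emeasure N (F i)) =
        (\<Sum>i. emeasure M (F i)) + (\<Sum>i. emeasure N (F i))"
      by (intro suminf_add[symmetric] summableI)
    also have "\<dots> = emeasure M (\<Union>i. F i) + emeasure N (\<Union>i. F i)"
      using F assms(1) by (subst (1 2) suminf_emeasure) auto
    finally show "(\<Sum>i. emeasure M (F i) + emeasure N (F i)) =
        emeasure M (\<Union>i. F i) + emeasure N (\<Union>i. F i)" .
  qed
qed (use assms in \<open>auto simp: positive_def dest: sets.sets_into_space\<close>)

lemma torus_flip_simp: "(a, b) \<in> torus \<Longrightarrow> torus_flip (a, b) = (inverse b, inverse a)"
  and torus_rot_simp: "(a, b) \<in> torus \<Longrightarrow> torus_rot (a, b) = (inverse b, a * inverse b)"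
  by (simp_all add: torus_flip_def torus_rot_def)

lemma torus_iff: "(a, b) \<in> torus \<longleftrightarrow> norm a = 1 \<and> norm b = 1"
  by (auto simp: torus_def)

lemma torus_nonzero: "(a, b) \<in> torus \<Longrightarrow> a \<noteq> 0 \<and> b \<noteq> 0"
  by (auto simp: torus_iff)

lemma torus_flip_closed: "x \<in> torus \<Longrightarrow> torus_flip x \<in> torus"
  by (cases x) (auto simp: torus_flip_simp torus_iff norm_inverse)

lemma torus_rot_closed: "x \<in> torus \<Longrightarrow> torus_rot x \<in> torus"
  by (cases x) (auto simp: torus_rot_simp torus_iff norm_inverse norm_mult)

lemma torus_flip_flip: "x \<in> torus \<Longrightarrow> torus_flip (torus_flip x) = x"
  using torus_flip_closed[of x] by (cases x) (simp add: torus_flip_simp)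

lemma torus_rot_rot:
  assumes "(a, b) \<in> torus" shows "torus_rot (torus_rot (a, b)) = (inverse a * b, inverse a)"
proof -
  have "(inverse b, a * inverse b) \<in> torus"
    using torus_rot_closed[OF assms] by (simp add: torus_rot_simp assms)
  then show ?thesis
    using torus_nonzero[OF assms] by (simp add: torus_rot_simp assms field_simps)
qed

lemma torus_rot_rot_rot:
  assumes "x \<in> torus" shows "torus_rot (torus_rot (torus_rot x)) = x"
proof (cases x)
  case (Pair a b)
  have t: "(inverse a * b, inverse a) \<in> torus"
    using torus_rot_closed[OF torus_rot_closed[OF assms]] assms by (simp add: Pair torus_rot_rot)
  have "torus_rot (torus_rot (torus_rot x)) = torus_rot (inverse a * b, inverse a)"
    using assms by (simp only: Pair torus_rot_rot)
  also have "\<dots> = (a, b)"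
    using t torus_nonzero[of a b] assms by (simp only: torus_rot_simp) (simp add: Pair)
  finally show ?thesis by (simp add: Pair)
qed

text \<open>The generators are elements of \<open>BijGroup torus\<close>, so \<open>subgroup_generated\<close> does not drop them.\<close>

lemma torus_generators_Bij: "torus_flip \<in> Bij torus" "torus_rot \<in> Bij torus"
proof -
  have "bij_betw torus_flip torus torus"
    by (rule bij_betwI[where g = torus_flip])
      (auto simp del: split_paired_All simp: torus_flip_closed torus_flip_flip)
  then show "torus_flip \<in> Bij torus"
    by (simp add: Bij_def torus_flip_def)
  have "bij_betw torus_rot torus torus"
    by (rule bij_betwI[where g = "torus_rot \<circ> torus_rot"])
      (auto simp: torus_rot_closed torus_rot_rot_rot)
  then show "torus_rot \<in> Bij torus"
    by (simp add: Bij_def torus_rot_def)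
qed

lemma carrier_torus_S3:
  "carrier torus_S3 = generate (BijGroup torus) {torus_flip, torus_rot}"
proof -
  have "{torus_flip, torus_rot} \<subseteq> carrier (BijGroup torus)"
    using torus_generators_Bij by (simp add: BijGroup_def)
  then show ?thesis
    by (simp add: torus_S3_def carrier_subgroup_generated Int_absorb1)
qed

lemma group_torus_S3: "group torus_S3"
  unfolding torus_S3_def by (rule group.group_subgroup_generated[OF group_BijGroup])

lemma S3_orbit_eq:
  assumes "(a, b) \<in> torus"
  shows "S3_orbit (a, b) =
    {(a, b), (inverse b, a * inverse b), (inverse a * b, inverse a),
     (inverse b, inverse a), (inverse a * b, b), (a, a * inverse b)}"
proof -
  interpret B: group "BijGroup torus" by (rule group_BijGroup)
  let ?f = torus_flip and ?r = torus_rot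
  let ?H = "{?f, ?r}"
  have f [simp]: "?f \<in> carrier (BijGroup torus)" and r [simp]: "?r \<in> carrier (BijGroup torus)"
    using torus_generators_Bij by (simp_all add: BijGroup_def)
  have mult: "(g \<otimes>\<^bsub>BijGroup torus\<^esub> h) x = g (h x)"
    if "g \<in> carrier (BijGroup torus)" "h \<in> carrier (BijGroup torus)" "x \<in> torus" for g h x
    using that by (simp add: BijGroup_def compose_eq)
  have gen: "generate (BijGroup torus) ?H \<subseteq> carrier (BijGroup torus)"
    by (rule B.generate_incl) simp
  define Q where "Q = (\<lambda>(a :: complex, b :: complex).
    {(a, b), (inverse b, a * inverse b), (inverse a * b, inverse a),
     (inverse b, inverse a), (inverse a * b, b), (a, a * inverse b)})"
  have torus_Q: "Q x \<subseteq> torus" if "x \<in> torus" for x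
    using that by (cases x) (auto simp: Q_def torus_iff norm_mult norm_inverse)
  have Q_f: "?f y \<in> Q x" and Q_r: "?r y \<in> Q x" if "x \<in> torus" "y \<in> Q x" for x y
  proof -
    obtain a b where x: "x = (a, b)" by (cases x)
    have nz: "a \<noteq> 0" "b \<noteq> 0" using torus_nonzero[of a b] that x by auto
    obtain c d where y: "y = (c, d)" by (cases y)
    have t: "(c, d) \<in> torus" using torus_Q[OF that(1)] that(2) unfolding y by (rule subsetD)
    show "?f y \<in> Q x"
      using that(2) nz unfolding y torus_flip_simp[OF t] unfolding x Q_def
      by (auto simp: mult.commute)
    show "?r y \<in> Q x"
      using that(2) nz unfolding y torus_rot_simp[OF t] unfolding x Q_def
      by (auto simp: mult.commute)
  qed
  have self: "x \<in> Q x" for x by (cases x) (auto simp: Q_def)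
  have inv_f: "inv\<^bsub>BijGroup torus\<^esub> ?f = ?f"
  proof (rule B.inv_equality)
    show "?f \<otimes>\<^bsub>BijGroup torus\<^esub> ?f = \<one>\<^bsub>BijGroup torus\<^esub>"
      using torus_generators_Bij
      by (auto simp: BijGroup_def compose_def torus_flip_flip intro!: restrict_ext)
  qed auto
  have inv_r: "inv\<^bsub>BijGroup torus\<^esub> ?r = ?r \<otimes>\<^bsub>BijGroup torus\<^esub> ?r"
  proof (rule B.inv_equality)
    show "(?r \<otimes>\<^bsub>BijGroup torus\<^esub> ?r) \<otimes>\<^bsub>BijGroup torus\<^esub> ?r = \<one>\<^bsub>BijGroup torus\<^esub>"
      using torus_generators_Bij compose_Bij[OF torus_generators_Bij(2) torus_generators_Bij(2)]
      by (auto simp: BijGroup_def compose_def torus_rot_rot_rot torus_rot_closed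
          intro!: restrict_ext)
  qed auto
  have step: "\<forall>x y. x \<in> torus \<longrightarrow> y \<in> Q x \<longrightarrow> g y \<in> Q x"
    if "g \<in> generate (BijGroup torus) ?H" for g
    using that
  proof (induction rule: generate.induct)
    case one
    show ?case using torus_Q by (fastforce simp: BijGroup_def)
  next
    case (incl h)
    then show ?case using Q_f Q_r by (simp only: insert_iff empty_iff) blast
  next
    case (inv h)
    show ?case
    proof (intro allI impI)
      fix x y assume xy: "x \<in> torus" "y \<in> Q x"
      then have "y \<in> torus" using torus_Q by blast
      then have "(?r \<otimes>\<^bsub>BijGroup torus\<^esub> ?r) y = ?r (?r y)" by (rule mult[OF r r])
      then show "(inv\<^bsub>BijGroup torus\<^esub> h) y \<in> Q x"
        using inv Q_f[OF xy] Q_r[OF xy(1) Q_r[OF xy]] by (auto simp: inv_f inv_r)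
    qed
  next
    case (eng g h)
    show ?case
    proof (intro allI impI)
      fix x y assume xy: "x \<in> torus" "y \<in> Q x"
      then have "y \<in> torus" using torus_Q by blast
      then have "(g \<otimes>\<^bsub>BijGroup torus\<^esub> h) y = g (h y)"
        using eng.hyps gen by (intro mult) auto
      then show "(g \<otimes>\<^bsub>BijGroup torus\<^esub> h) y \<in> Q x"
        using eng.IH xy by (simp del: split_paired_All)
    qed
  qed
  have orb: "S3_orbit x = (\<lambda>g. g x) ` generate (BijGroup torus) ?H" for x
    by (auto simp: S3_orbit_def orbit_def carrier_torus_S3)
  have upper: "S3_orbit (a, b) \<subseteq> Q (a, b)"
    using step assms self[of "(a, b)"] unfolding orb by blast
  have in_f: "?f y \<in> S3_orbit (a, b)" and in_r: "?r y \<in> S3_orbit (a, b)"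
    if y: "y \<in> S3_orbit (a, b)" for y
  proof -
    obtain g where g: "g \<in> generate (BijGroup torus) ?H" "y = g (a, b)"
      using y unfolding orb by blast
    have *: "h y \<in> S3_orbit (a, b)" if "h \<in> ?H" for h
    proof -
      have h: "h \<in> carrier (BijGroup torus)" using that by auto
      have "(h \<otimes>\<^bsub>BijGroup torus\<^esub> g) (a, b) = h y"
        using h g gen assms mult[of h g "(a, b)"] by auto
      moreover have "h \<otimes>\<^bsub>BijGroup torus\<^esub> g \<in> generate (BijGroup torus) ?H"
        by (rule generate.eng[OF generate.incl[OF that] g(1)])
      ultimately show ?thesis unfolding orb by (metis imageI)
    qed
    show "?f y \<in> S3_orbit (a, b)" "?r y \<in> S3_orbit (a, b)" using * by auto
  qed
  have "\<one>\<^bsub>BijGroup torus\<^esub> (a, b) = (a, b)" using assms by (simp add: BijGroup_def)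
  then have 0: "(a, b) \<in> S3_orbit (a, b)"
    unfolding orb using generate.one[of "BijGroup torus" ?H] by (metis imageI)
  have r1: "?r (a, b) = (inverse b, a * inverse b)" by (rule torus_rot_simp[OF assms])
  have r2: "?r (?r (a, b)) = (inverse a * b, inverse a)" by (rule torus_rot_rot[OF assms])
  have t1: "(inverse b, a * inverse b) \<in> torus" "(inverse a * b, inverse a) \<in> torus"
    using assms by (simp_all add: torus_iff norm_mult norm_inverse)
  have f0: "?f (a, b) = (inverse b, inverse a)" by (rule torus_flip_simp[OF assms])
  have f1: "?f (?r (a, b)) = (inverse a * b, b)"
    unfolding r1 torus_flip_simp[OF t1(1)] by (simp add: mult.commute)
  have f2: "?f (?r (?r (a, b))) = (a, a * inverse b)"
    unfolding r2 torus_flip_simp[OF t1(2)] by (simp add: mult.commute)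
  have "Q (a, b) \<subseteq> S3_orbit (a, b)"
    using 0 in_r[OF 0, unfolded r1] in_r[OF in_r[OF 0], unfolded r2] in_f[OF 0, unfolded f0]
      in_f[OF in_r[OF 0], unfolded f1] in_f[OF in_r[OF in_r[OF 0]], unfolded f2]
    by (simp add: Q_def)
  with upper show ?thesis by (auto simp: Q_def)
qed

lemma S3_orbit_finite: "x \<in> torus \<Longrightarrow> finite (S3_orbit x)"
  and S3_orbit_nonempty: "x \<in> torus \<Longrightarrow> S3_orbit x \<noteq> {}"
  and S3_orbit_subset: "x \<in> torus \<Longrightarrow> S3_orbit x \<subseteq> torus"
  by (cases x; auto simp: S3_orbit_eq torus_iff norm_mult norm_inverse)+

lemma prob_space_uniform_on:
  assumes "finite S" "S \<noteq> {}" "S \<subseteq> torus"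
  shows "prob_space (uniform_on S)"
proof -
  interpret prob_space "uniform_count_measure S"
    using assms by (intro prob_space_uniform_count_measure)
  show ?thesis
    unfolding uniform_on_def using assms(3)
    by (intro prob_space_distr)
      (auto simp: measurable_def space_uniform_count_measure sets_uniform_count_measure)
qed

lemma d_diag_points:
  "finite (d_diag_points s)" "d_diag_points s \<noteq> {}" "d_diag_points s \<subseteq> torus"
  unfolding d_diag_points_def
  by (simp_all add: S3_orbit_finite S3_orbit_nonempty S3_orbit_subset torus_iff norm_mult)

lemma d_pair_points:
  "finite (d_pair_points s k)" "d_pair_points s k \<noteq> {}" "d_pair_points s k \<subseteq> torus"
  unfolding d_pair_points_def
  by (simp_all add: S3_orbit_finite S3_orbit_nonempty S3_orbit_subset torus_iff norm_mult)

lemma prob_space_d_diag: "prob_space (d_diag s)"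
  and prob_space_d_pair: "prob_space (d_pair s k)"
  unfolding d_diag_def d_pair_def
  by (intro prob_space_uniform_on d_diag_points d_pair_points)+

end

theory Submission
  imports Defs
begin

text \<open>On the torus \<open>R m n\<close> equals \<open>t ^ m * cnj t ^ n\<close>, where \<open>t = R 1 0\<close> is invariant under \<open>S\<^sub>3\<close>. On
  each of the three point sets \<open>t\<close> separates the orbits, and each orbit has six elements, so the
  measures push forward under \<open>t\<close> to the uniform measures on the sets of all \<open>c * (1 + sqrt 2)\<close>,
  of all \<open>c * (1 - sqrt 2)\<close> and of all \<open>\<plusminus>\<i> * c\<close>, where \<open>c ^ 3 = 1\<close>. These are the twelve
  eigenvalues \<open>l\<close> of the normal matrix of \<open>\<E>\<^sup>(\<^sup>8\<^sup>)\<close>. By the rotational symmetry of the graph,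
  there are eigenvectors of the form \<open>o\<^sub>r \<mapsto> \<chi>(r)\<close>, \<open>p\<^sub>r \<mapsto> l * \<chi>(r)\<close> with \<open>\<chi>\<close> a character of the
  integers modulo 6, and the coefficients of \<open>e\<^sub>*\<close> with respect to them are the masses of the
  image measure.\<close>

subsection \<open>Integration with respect to sums and multiples of measures\<close>

text \<open>Both sides are additive and homogeneous in \<open>f\<close> and continuous along
  increasing sequences, so it is enough to compare them on indicators. In the limit,
  \<open>ennreal_SUP_add\<close> splits the supremum because both sequences of integrals
  increase.\<close>

lemma nn_integral_add_measure:
  assumes sets: "sets M = sets N" and f: "f \<in> borel_measurable M"
  shows "(\<integral>\<^sup>+x. f x \<partial>add_measure M N) = (\<integral>\<^sup>+x. f x \<partial>M) + (\<integral>\<^sup>+x. f x \<partial>N)"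
proof -
  note space = sets_eq_imp_space_eq[OF sets]
  note [measurable_cong] = sets[symmetric] sets_add_measure[of M N]
  show ?thesis
    using f
  proof (induction rule: borel_measurable_induct)
    case (cong f g)
    then show ?case by (simp add: space cong: nn_integral_cong_simp)
  next
    case (set A)
    moreover from set have "A \<in> sets N" by (simp add: sets)
    ultimately show ?case using emeasure_add_measure[OF sets set] by simp
  next
    case (mult u c)
    then show ?case by (simp add: nn_integral_cmult distrib_left)
  next
    case (add u v)
    then show ?case by (simp add: nn_integral_add ac_simps)
  next
    case (seq U)
    have mono: "incseq (\<lambda>i. \<integral>\<^sup>+x. U i x \<partial>M)" "incseq (\<lambda>i. \<integral>\<^sup>+x. U i x \<partial>N)"
      using seq by (auto simp: incseq_def le_fun_def intro!: nn_integral_mono)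
    have "(\<integral>\<^sup>+x. (SUP i. U i x) \<partial>add_measure M N) = (SUP i. (\<integral>\<^sup>+x. U i x \<partial>M) + (\<integral>\<^sup>+x. U i x \<partial>N))"
      using seq by (subst nn_integral_monotone_convergence_SUP) (auto simp: mono)
    also have "\<dots> = (SUP i. \<integral>\<^sup>+x. U i x \<partial>M) + (SUP i. \<integral>\<^sup>+x. U i x \<partial>N)"
      using mono by (rule ennreal_SUP_add)
    also have "\<dots> = (\<integral>\<^sup>+x. (SUP i. U i x) \<partial>M) + (\<integral>\<^sup>+x. (SUP i. U i x) \<partial>N)"
      using seq by (simp add: nn_integral_monotone_convergence_SUP)
    finally show ?case by (simp add: image_comp SUP_apply)
  qed
qed

lemma
  fixes f :: "'a \<Rightarrow> 'b::{banach, second_countable_topology}"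
  assumes sets: "sets M = sets N" and f: "integrable M f" "integrable N f"
  shows integrable_add_measure: "integrable (add_measure M N) f"
    and integral_add_measure: "(\<integral>x. f x \<partial>add_measure M N) = (\<integral>x. f x \<partial>M) + (\<integral>x. f x \<partial>N)"
proof -
  note space = sets_eq_imp_space_eq[OF sets]
  note [measurable_cong] = sets[symmetric] sets_add_measure[of M N]
  \<comment> \<open>Measurability depends on the sigma-algebra alone, and the nonnegative integral
    of the norm is already known to be additive.\<close>
  have iff: "integrable (add_measure M N) g \<longleftrightarrow> integrable M g \<and> integrable N g" for g :: "'a \<Rightarrow> 'b"
    unfolding integrable_iff_bounded
    by (auto simp: nn_integral_add_measure sets ennreal_add_less_top
        measurable_cong_sets[OF sets refl] measurable_cong_sets[OF sets_add_measure refl])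
  show int: "integrable (add_measure M N) f" using f iff by blast
  then show "(\<integral>x. f x \<partial>add_measure M N) = (\<integral>x. f x \<partial>M) + (\<integral>x. f x \<partial>N)"
  proof induct
    case (base A c)
    then have A: "A \<in> sets M" "A \<in> sets N" by (simp_all add: sets)
    then have fin: "emeasure M A < \<infinity>" "emeasure N A < \<infinity>"
      using base(2) by (simp_all add: emeasure_add_measure[OF sets A(1)])
    then have "measure (add_measure M N) A = measure M A + measure N A"
      by (simp add: measure_def emeasure_add_measure[OF sets A(1)] enn2real_plus)
    then show ?case using A fin by (simp add: scaleR_left_distrib emeasure_add_measure[OF sets A(1)])
  next
    case (add f g)
    then show ?case by (simp add: iff)
  next
    case (lim f s)
    have s: "s i \<in> borel_measurable M" "s i \<in> borel_measurable N" for i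
      using lim(1)[of i] unfolding iff by (auto intro: borel_measurable_integrable)
    \<comment> \<open>Stated for any \<open>L\<close> on the same space, so that one domination
      argument, with majorant \<open>2 * norm (f x)\<close>, serves \<open>M\<close>,
      \<open>N\<close> and their sum.\<close>
    have conv: "(\<lambda>i. \<integral>x. s i x \<partial>L) \<longlonglongrightarrow> (\<integral>x. f x \<partial>L)"
      if "integrable L f" "\<And>i. s i \<in> borel_measurable L" "space L = space M" for L
      using lim(3,4) that
      by (intro integral_dominated_convergence[where w = "\<lambda>x. 2 * norm (f x)"])
        (auto intro: borel_measurable_integrable)
    have "(\<lambda>i. \<integral>x. s i x \<partial>add_measure M N) \<longlonglongrightarrow> (\<integral>x. f x \<partial>M) + (\<integral>x. f x \<partial>N)"
      unfolding lim(2) using lim(5) unfolding iff by (intro tendsto_add conv) (simp_all add: s space)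
    moreover have "(\<lambda>i. \<integral>x. s i x \<partial>add_measure M N) \<longlonglongrightarrow> (\<integral>x. f x \<partial>add_measure M N)"
      using lim(1,5) by (intro conv) (auto intro: borel_measurable_integrable)
    ultimately show ?case using LIMSEQ_unique by blast
  qed
qed

lemma
  fixes f :: "'a \<Rightarrow> 'b::{banach, second_countable_topology}"
  assumes "integrable M f" "0 \<le> r"
  shows integrable_scale_measure: "integrable (scale_measure (ennreal r) M) f"
    and integral_scale_measure: "(\<integral>x. f x \<partial>scale_measure (ennreal r) M) = r *\<^sub>R (\<integral>x. f x \<partial>M)"
proof -
  \<comment> \<open>Scaling is multiplication by a constant density, which reduces both claims to
    integration against a density.\<close>
  have eq: "scale_measure (ennreal r) M = density M (\<lambda>_. ennreal r)"
    by (rule measure_eqI) (auto simp: emeasure_density_const)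
  show "integrable (scale_measure (ennreal r) M) f"
    "(\<integral>x. f x \<partial>scale_measure (ennreal r) M) = r *\<^sub>R (\<integral>x. f x \<partial>M)"
    using assms unfolding eq by (simp_all add: integrable_density integral_density)
qed

subsection \<open>Cube roots of unity\<close>

abbreviation cube_roots :: "complex set" where
  "cube_roots \<equiv> {1, \<omega>, cnj \<omega>}"

lemma expi_cis: "expi x = cis (2 * pi * x)"
  by (simp add: cis_conv_exp mult_ac)

lemma cnj_expi: "cnj (expi x) = expi (- x)"
  unfolding expi_cis by (simp add: cis_cnj)

lemma cnj_eq_inverse:
  assumes "norm z = 1"
  shows "cnj z = inverse z"
proof -
  have "z * cnj z = 1" using assms by (simp flip: complex_norm_square)
  then show ?thesis by (metis inverse_unique)
qed

lemma norm_expi: "norm (expi x) = 1"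
  unfolding expi_cis by simp

lemma omega_eq: "\<omega> = Complex (- 1 / 2) (sqrt 3 / 2)"
  unfolding expi_cis by (rule complex_eqI) (simp_all add: cos_120 sin_120)

lemma omega_facts:
  "\<omega> ^ 3 = 1" "cnj \<omega> = \<omega>\<^sup>2" "1 + \<omega> + cnj \<omega> = 0" "\<omega> \<noteq> 1" "\<omega> \<noteq> cnj \<omega>" "cnj \<omega> \<noteq> 1"
  unfolding omega_eq by (auto simp: complex_eq_iff power2_eq_square power3_eq_cube)

lemma sum_cube_roots: "(\<Sum>c\<in>cube_roots. f c) = f 1 + f \<omega> + f (cnj \<omega>)"
proof -
  have "1 \<notin> {\<omega>, cnj \<omega>}" "\<omega> \<notin> {cnj \<omega>}"
    unfolding insert_iff empty_iff using omega_facts(4-6) by metis+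
  then show ?thesis by (simp only: sum.insert finite.intros sum.empty add.assoc add_0_right empty_iff simp_thms)
qed

lemma cube_root_facts:
  assumes "c \<in> cube_roots"
  shows "c ^ 3 = 1" "cnj c = c\<^sup>2"
proof -
  have "(cnj \<omega>) ^ 3 = 1" by (simp only: omega_facts(1) complex_cnj_one flip: complex_cnj_power)
  moreover have "cnj (cnj \<omega>) = (cnj \<omega>)\<^sup>2"
    using arg_cong[OF omega_facts(2), of cnj] unfolding complex_cnj_power .
  ultimately show "c ^ 3 = 1" "cnj c = c\<^sup>2"
    using assms omega_facts(1,2) complex_cnj_one power_one by (metis insertE singletonD)+
qed

subsection \<open>Eigenvectors of \<open>\<E>\<^sup>(\<^sup>8\<^sup>)\<close>\<close>

text \<open>Arcs are pairs of vertices, so there are no parallel arcs and every matrix entry is 0 or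
  1.\<close>

lemma E8_matrix_vector:
  "(adjacency_matrix E8 *v x) $ v = (\<Sum>w | (v, w) \<in> E8_arcs. x $ w)"
  "(adjoint_matrix (adjacency_matrix E8) *v x) $ v = (\<Sum>w | (w, v) \<in> E8_arcs. x $ w)"
proof -
  have "{e \<in> E8_arcs. fst e = v \<and> snd e = w} = (if (v, w) \<in> E8_arcs then {(v, w)} else {})" for v w
    by auto
  then have A: "adjacency_matrix E8 $ v $ w = (if (v, w) \<in> E8_arcs then 1 else 0)" for v w
    by (simp add: adjacency_matrix_def E8_def)
  show "(adjacency_matrix E8 *v x) $ v = (\<Sum>w | (v, w) \<in> E8_arcs. x $ w)"
    "(adjoint_matrix (adjacency_matrix E8) *v x) $ v = (\<Sum>w | (w, v) \<in> E8_arcs. x $ w)"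
    by (auto simp: matrix_vector_mult_def adjoint_matrix_def A intro!: sum.mono_neutral_cong_right
        split: if_splits)
qed

lemma E8_adjacency_simps:
  "(adjacency_matrix E8 *v x) $ Vo r = x $ Vp r"
  "(adjacency_matrix E8 *v x) $ Vp r = x $ Vp (r + 1) + x $ Vp (r - 2) + x $ Vo (r - 1)"
proof -
  have "{w. (Vo r, w) \<in> E8_arcs} = {Vp r}"
    and "{w. (Vp r, w) \<in> E8_arcs} = {Vp (r + 1), Vp (r - 2), Vo (r - 1)}"
    by (auto simp: E8_arcs_def)
  \<comment> \<open>The two differ by 3, which is nonzero modulo 6, so the sum over the successors
    really has three terms.\<close>
  moreover have "r + 1 \<noteq> r - 2" by (simp add: algebra_simps)
  ultimately show "(adjacency_matrix E8 *v x) $ Vo r = x $ Vp r"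
    "(adjacency_matrix E8 *v x) $ Vp r = x $ Vp (r + 1) + x $ Vp (r - 2) + x $ Vo (r - 1)"
    by (simp_all add: E8_matrix_vector)
qed

lemma E8_adjoint_simps:
  "(adjoint_matrix (adjacency_matrix E8) *v x) $ Vo r = x $ Vp (r + 1)"
  "(adjoint_matrix (adjacency_matrix E8) *v x) $ Vp r = x $ Vo r + x $ Vp (r - 1) + x $ Vp (r + 2)"
proof -
  have "{w. (w, Vo r) \<in> E8_arcs} = {Vp (r + 1)}"
    and "{w. (w, Vp r) \<in> E8_arcs} = {Vo r, Vp (r - 1), Vp (r + 2)}"
    by (auto simp: E8_arcs_def algebra_simps)
  moreover have "r - 1 \<noteq> r + 2" by (simp add: algebra_simps)
  ultimately show "(adjoint_matrix (adjacency_matrix E8) *v x) $ Vo r = x $ Vp (r + 1)"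
    "(adjoint_matrix (adjacency_matrix E8) *v x) $ Vp r = x $ Vo r + x $ Vp (r - 1) + x $ Vp (r + 2)"
    by (simp_all add: E8_matrix_vector)
qed

text \<open>The neighbour formulas give the same value for both products at every vertex; at
  \<open>Vo r\<close>, for instance, it is
  \<open>x $ Vo r + x $ Vp (r - 1) + x $ Vp (r + 2)\<close>.\<close>

lemma E8_normal:
  fixes D :: "complex ^ e8_vertex ^ e8_vertex"
  defines "D \<equiv> adjacency_matrix E8"
  shows "D ** adjoint_matrix D = adjoint_matrix D ** D"
proof -
  have "(D *v (adjoint_matrix D *v x)) $ v = (adjoint_matrix D *v (D *v x)) $ v" for x v
    by (cases v) (simp_all add: D_def E8_adjacency_simps E8_adjoint_simps algebra_simps)
  then show ?thesis
    unfolding matrix_eq matrix_vector_mul_assoc[symmetric] vec_eq_iff by blast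
qed

section \<open>Characters of the integers modulo 6\<close>

definition zmod6_char :: "complex \<Rightarrow> 6 \<Rightarrow> complex" where
  "zmod6_char c r = c ^ nat (Rep_bit0 r)"

lemma zmod6_char_of_nat:
  assumes "c ^ 6 = 1"
  shows "zmod6_char c (of_nat k) = c ^ k"
proof -
  have "Rep_bit0 (of_nat k :: 6) = int k mod 6"
    by (simp add: bit0.of_nat_eq bit0.Rep_Abs_mod[where 'a = 3, simplified])
  then have "zmod6_char c (of_nat k) = c ^ (k mod 6)"
    by (simp add: zmod6_char_def nat_mod_as_int)
  also have "\<dots> = c ^ (k mod 6 + 6 * (k div 6))"
    unfolding power_add power_mult assms by simp
  finally show ?thesis by (simp only: mod_mult_div_eq)
qed

text \<open>The last clause transfers the test for the vertex \<open>Vo 0\<close> to the exponent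
  \<open>k\<close>; it holds because a multiple of 6 below 6 is 0.\<close>

lemma zmod6_exhaust:
  obtains k :: nat where "k < 6" "(r :: 6) = of_nat k" "r = 0 \<longleftrightarrow> k = 0"
proof (cases r)
  case (of_int z)
  then have "r = of_nat (nat z)" "nat z < 6" by simp_all
  moreover from this have "r = 0 \<longleftrightarrow> nat z = 0"
    by (auto simp: of_nat_eq_0_iff_char_dvd simp del: of_nat_nat dest: dvd_imp_le)
  ultimately show ?thesis by (intro that)
qed

lemma zmod6_char_add:
  assumes "c ^ 6 = 1"
  shows "zmod6_char c (r + of_nat j) = c ^ j * zmod6_char c r"
proof -
  obtain k where "r = of_nat k" by (rule zmod6_exhaust)
  then show ?thesis
    using zmod6_char_of_nat[OF assms, of "k + j"] zmod6_char_of_nat[OF assms, of k]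
    by (simp add: power_add)
qed

text \<open>Modulo 6, subtracting 1 or 2 is adding 5 or 4, so every shift along an arc becomes a
  natural power of \<open>c\<close> and no inverse appears.\<close>

lemma zmod6_char_shift:
  assumes "c ^ 6 = 1"
  shows "zmod6_char c (r + 1) = c * zmod6_char c r"
    and "zmod6_char c (r + 2) = c\<^sup>2 * zmod6_char c r"
    and "zmod6_char c (r - 1) = c ^ 5 * zmod6_char c r"
    and "zmod6_char c (r - 2) = c ^ 4 * zmod6_char c r"
proof -
  have "r - 1 = r + of_nat 5" "r - 2 = r + of_nat 4" "r + 1 = r + of_nat 1" "r + 2 = r + of_nat 2"
    by (simp_all add: algebra_simps)
  then show "zmod6_char c (r + 1) = c * zmod6_char c r"
    "zmod6_char c (r + 2) = c\<^sup>2 * zmod6_char c r"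
    "zmod6_char c (r - 1) = c ^ 5 * zmod6_char c r"
    "zmod6_char c (r - 2) = c ^ 4 * zmod6_char c r"
    by (simp_all only: zmod6_char_add[OF assms] power_one_right)
qed

text \<open>The only arc leaving \<open>Vo r\<close> goes to \<open>Vp r\<close>, so the eigenvalue
  equation there forces the value at \<open>Vp r\<close> to be \<open>l\<close> times the value at
  \<open>Vo r\<close>.\<close>

definition E8_eigvec :: "complex \<Rightarrow> complex \<Rightarrow> complex ^ e8_vertex" where
  "E8_eigvec l c = (\<chi> v. case v of Vo r \<Rightarrow> zmod6_char c r | Vp r \<Rightarrow> l * zmod6_char c r)"

lemma E8_eigvec_simps [simp]:
  "E8_eigvec l c $ Vo r = zmod6_char c r" "E8_eigvec l c $ Vp r = l * zmod6_char c r"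
  by (simp_all add: E8_eigvec_def)

text \<open>The hypotheses are eigenvalue equations in disguise. The quadratic one is that of the
  adjacency matrix at \<open>Vp r\<close>, with \<open>c ^ 5\<close> and \<open>c ^ 4\<close>
  standing for the inverses of \<open>c\<close> and \<open>c\<^sup>2\<close>;
  \<open>cnj l = c * l\<close> is that of the adjoint at \<open>Vo r\<close>.\<close>

lemma
  assumes c: "c ^ 6 = 1" and l: "l\<^sup>2 = l * (c + c ^ 4) + c ^ 5" and cnj: "cnj l = c * l"
  shows E8_adjacency_eigvec: "adjacency_matrix E8 *v E8_eigvec l c = l *s E8_eigvec l c"
    and E8_adjoint_eigvec:
      "adjoint_matrix (adjacency_matrix E8) *v E8_eigvec l c = cnj l *s E8_eigvec l c"
proof -
  have l': "l * l = l * (c + c ^ 4) + c ^ 5" using l by (simp add: power2_eq_square)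
  \<comment> \<open>The remaining equation, that of the adjoint at \<open>Vp r\<close>, is the
    quadratic one multiplied by \<open>c\<close>.\<close>
  have cl: "cnj l * l = 1 + l * (c ^ 5 + c ^ 2)"
  proof -
    have "cnj l * l = c * (l * l)" by (simp add: cnj)
    also have "\<dots> = c ^ 6 + l * (c ^ 5 + c ^ 2)" unfolding l' by (simp add: algebra_simps eval_nat_numeral)
    finally show ?thesis by (simp add: c)
  qed
  show "adjacency_matrix E8 *v E8_eigvec l c = l *s E8_eigvec l c"
    unfolding vec_eq_iff
  proof
    fix v show "(adjacency_matrix E8 *v E8_eigvec l c) $ v = (l *s E8_eigvec l c) $ v"
    proof (cases v)
      case (Vp r)
      have "(adjacency_matrix E8 *v E8_eigvec l c) $ v = (l * (c + c ^ 4) + c ^ 5) * zmod6_char c r"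
        unfolding Vp E8_adjacency_simps E8_eigvec_simps zmod6_char_shift[OF c]
        by (simp add: algebra_simps)
      also have "\<dots> = l * (l * zmod6_char c r)" by (simp only: l'[symmetric] mult.assoc)
      finally show ?thesis by (simp add: Vp)
    qed (simp add: E8_adjacency_simps)
  qed
  show "adjoint_matrix (adjacency_matrix E8) *v E8_eigvec l c = cnj l *s E8_eigvec l c"
    unfolding vec_eq_iff
  proof
    fix v show "(adjoint_matrix (adjacency_matrix E8) *v E8_eigvec l c) $ v = (cnj l *s E8_eigvec l c) $ v"
    proof (cases v)
      case (Vp r)
      have "(adjoint_matrix (adjacency_matrix E8) *v E8_eigvec l c) $ v
          = (1 + l * (c ^ 5 + c ^ 2)) * zmod6_char c r"
        unfolding Vp E8_adjoint_simps E8_eigvec_simps zmod6_char_shift[OF c]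
        by (simp add: algebra_simps)
      also have "\<dots> = cnj l * (l * zmod6_char c r)" by (simp only: cl[symmetric] mult.assoc)
      finally show ?thesis by (simp add: Vp)
    next
      case (Vo r)
      then show ?thesis by (simp add: E8_adjoint_simps zmod6_char_shift[OF c] cnj)
    qed
  qed
qed

section \<open>Moments of the graph at its distinguished vertex\<close>

lemma matrix_power_eigenvector:
  assumes "A *v u = l *s u"
  shows "matrix_power A n *v u = l ^ n *s u"
proof (induction n)
  case (Suc n)
  have "matrix_power A (Suc n) *v u = A *v (matrix_power A n *v u)"
    by (simp add: matrix_power_def matrix_vector_mul_assoc)
  also have "\<dots> = l ^ n *s (A *v u)"
    unfolding Suc by (rule vector_scalar_commute)
  finally show ?case by (simp add: assms mult.commute)
qed (simp add: matrix_power_def)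

lemma E8_moment_eigvec:
  fixes D :: "complex ^ e8_vertex ^ e8_vertex"
  defines "D \<equiv> adjacency_matrix E8"
  assumes "c ^ 6 = 1" "l\<^sup>2 = l * (c + c ^ 4) + c ^ 5" "cnj l = c * l"
  shows "(matrix_power D m ** matrix_power (adjoint_matrix D) n) *v E8_eigvec l c =
    (l ^ m * cnj l ^ n) *s E8_eigvec l c"
proof -
  note D = E8_adjacency_eigvec[OF assms(2-), folded D_def]
    and D' = E8_adjoint_eigvec[OF assms(2-), folded D_def]
  show ?thesis
    unfolding matrix_vector_mul_assoc[symmetric] matrix_power_eigenvector[OF D']
      vector_scalar_commute matrix_power_eigenvector[OF D]
    by (simp add: vector_smult_assoc mult.commute)
qed

text \<open>The basis vector is a combination of eigenvectors that take the value 1 at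
  \<open>Vo 0\<close>, so its coefficients become the weights of the eigenvalues. The characters
  given by \<open>c\<close> and \<open>- c\<close>, for \<open>c\<close> a cube root of unity, are
  all six characters, and each has two eigenvalues.\<close>

lemma E8_moments:
  fixes D :: "complex ^ e8_vertex ^ e8_vertex" and m n :: nat
  defines "D \<equiv> adjacency_matrix E8" and "p \<equiv> (\<lambda>z :: complex. z ^ m * cnj z ^ n)"
  shows "hermitian_inner ((matrix_power D m ** matrix_power (adjoint_matrix D) n) *v axis (Vo 0) 1)
      (axis (Vo 0) 1) =
    (\<Sum>c\<in>cube_roots. of_real ((2 - sqrt 2) / 24) * p (c * of_real (1 + sqrt 2)) +
      of_real ((2 + sqrt 2) / 24) * p (c * of_real (1 - sqrt 2)) +
      1 / 12 * p (c * \<i>) + 1 / 12 * p (c * (- \<i>)))"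
proof -
  let ?a = "of_real ((2 - sqrt 2) / 24) :: complex" and ?b = "of_real ((2 + sqrt 2) / 24) :: complex"
  let ?l = "of_real (1 + sqrt 2) :: complex" and ?l' = "of_real (1 - sqrt 2) :: complex"
  let ?M = "matrix_power D m ** matrix_power (adjoint_matrix D) n"
  \<comment> \<open>The two coefficients belonging to one character add up to 1/6, which settles the
    vertices \<open>Vo r\<close> by orthogonality of characters. Weighted by their eigenvalues they
    cancel, which settles the vertices \<open>Vp r\<close>. These two equations determine the
    coefficients.\<close>
  define u where "u c = ?a *s E8_eigvec (c * ?l) c + ?b *s E8_eigvec (c * ?l') c
    + (1 / 12) *s E8_eigvec (c * \<i>) (- c) + (1 / 12) *s E8_eigvec (c * (- \<i>)) (- c)" for c
  have delta: "axis (Vo 0) 1 = (\<Sum>c\<in>cube_roots. u c)"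
    unfolding vec_eq_iff
  proof
    fix v show "axis (Vo 0) 1 $ v = (\<Sum>c\<in>cube_roots. u c) $ v"
    proof (cases v)
      case (Vo r)
      obtain k where k: "k < 6" "r = of_nat k" "r = 0 \<longleftrightarrow> k = 0" by (rule zmod6_exhaust)
      have ch: "zmod6_char c r = c ^ k" "zmod6_char (- c) r = (- 1) ^ k * c ^ k"
        if "c \<in> cube_roots" for c
      proof -
        have "c ^ 6 = (c ^ 3)\<^sup>2" "(- c) ^ 6 = (c ^ 3)\<^sup>2" by (simp_all flip: power_mult)
        then have "c ^ 6 = 1" "(- c) ^ 6 = 1" using cube_root_facts[OF that] by simp_all
        then show "zmod6_char c r = c ^ k" "zmod6_char (- c) r = (- 1) ^ k * c ^ k"
          by (simp_all add: zmod6_char_of_nat k(2) power_minus[of c])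
      qed
      have "(\<Sum>c\<in>cube_roots. u c $ v) = (\<Sum>c\<in>cube_roots. c ^ k * ((1 + (- 1) ^ k) / 6))"
        by (rule sum.cong) (simp_all only: u_def Vo vector_add_component vector_smult_component
            E8_eigvec_simps ch, simp add: field_simps)
      also have "\<dots> = (1 + \<omega> ^ k + (cnj \<omega>) ^ k) * ((1 + (- 1) ^ k) / 6)"
        by (simp only: sum_cube_roots distrib_right power_one)
      \<comment> \<open>Odd \<open>k\<close> are killed by the factor \<open>1 + (- 1) ^ k\<close>,
        and \<open>k = 2\<close>, \<open>k = 4\<close> by the vanishing sum of the cube roots of
        unity.\<close>
      also have "\<dots> = (if k = 0 then 1 else 0)"
      proof -
        have s2: "1 + \<omega>\<^sup>2 + (cnj \<omega>)\<^sup>2 = 0"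
          using omega_facts(1-3) by algebra
        have s4: "1 + \<omega> ^ 4 + (cnj \<omega>) ^ 4 = 0"
          using omega_facts(1-3) by algebra
        have even: "k = 0 \<or> k = 2 \<or> k = 4 \<or> odd k" using k(1) by presburger
        consider "k = 0" | "k = 2" | "k = 4" | "odd k"
          using even by blast
        then show ?thesis
        proof cases
          case 2
          show ?thesis unfolding 2 s2 by simp
        next
          case 3
          show ?thesis unfolding 3 s4 by simp
        qed (auto simp: odd_pos)
      qed
      finally show ?thesis
        unfolding sum_component by (simp only: axis_def vec_lambda_beta Vo e8_vertex.inject k(3) eq_commute[of 0])
    next
      case (Vp r)
      have "?a * ?l + ?b * ?l' = 0"
        by (simp add: field_simps flip: of_real_mult of_real_add of_real_diff)
      \<comment> \<open>The terms with \<open>\<i>\<close> and \<open>- \<i>\<close> cancel because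
        they carry the same character value \<open>z'\<close>.\<close>
      moreover have alg: "a * (c * l * z) + b * (c * l' * z) + 1 / 12 * (c * \<i> * z')
          + 1 / 12 * (c * (- \<i>) * z') = (a * l + b * l') * (c * z)" for a b c l l' z z' :: complex
        by (simp add: algebra_simps)
      have "u c $ v = (?a * ?l + ?b * ?l') * (c * zmod6_char c r)" for c
        unfolding u_def Vp vector_add_component vector_smult_component E8_eigvec_simps by (rule alg)
      ultimately have "u c $ v = 0" for c by simp
      then show ?thesis by (simp add: axis_def Vp)
    qed
  qed
  have eig: "?M *v u c = (?a * p (c * ?l)) *s E8_eigvec (c * ?l) c
      + (?b * p (c * ?l')) *s E8_eigvec (c * ?l') c
      + (1 / 12 * p (c * \<i>)) *s E8_eigvec (c * \<i>) (- c)
      + (1 / 12 * p (c * (- \<i>))) *s E8_eigvec (c * (- \<i>)) (- c)"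
    if "c \<in> cube_roots" for c
  proof -
    have c3: "c ^ 3 = 1" and cnj: "cnj c = c\<^sup>2" using cube_root_facts[OF that] by auto
    have pw: "c ^ 4 = c" "c ^ 5 = c\<^sup>2" "c ^ 6 = 1"
      using c3 power_add[of c 3 1] power_add[of c 3 2] power_add[of c 3 3] by simp_all
    \<comment> \<open>As \<open>c ^ 4 = c\<close> and \<open>c ^ 5 = c\<^sup>2\<close>, the
      quadratic equation for the eigenvalue \<open>c * x\<close> reduces to
      \<open>x\<^sup>2 = 2 * x + 1\<close>, with the real roots \<open>1 + sqrt 2\<close> and
      \<open>1 - sqrt 2\<close>.\<close>
    have real: "?M *v E8_eigvec (c * x) c = p (c * x) *s E8_eigvec (c * x) c"
      if "x\<^sup>2 = 2 * x + 1" "cnj x = x" for x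
      unfolding D_def p_def
    proof (rule E8_moment_eigvec)
      show "(c * x)\<^sup>2 = c * x * (c + c ^ 4) + c ^ 5"
        unfolding pw(1,2) power_mult_distrib that(1) by (simp add: algebra_simps power2_eq_square)
      show "cnj (c * x) = c * (c * x)" by (simp add: cnj that(2) power2_eq_square)
    qed (rule pw(3))
    \<comment> \<open>For the character of \<open>- c\<close> the coefficient
      \<open>- c + (- c) ^ 4\<close> of the linear term is 0, which leaves
      \<open>x\<^sup>2 = - 1\<close>.\<close>
    have imag: "?M *v E8_eigvec (c * x) (- c) = p (c * x) *s E8_eigvec (c * x) (- c)"
      if "x\<^sup>2 = - 1" "cnj x = - x" for x
      unfolding D_def p_def
    proof (rule E8_moment_eigvec)
      show "(c * x)\<^sup>2 = c * x * (- c + (- c) ^ 4) + (- c) ^ 5"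
        by (simp add: pw power_mult_distrib that(1))
      show "cnj (c * x) = - c * (c * x)" by (simp add: cnj that(2) power2_eq_square)
    qed (simp add: pw(3))
    have "(1 + sqrt 2)\<^sup>2 = 2 * (1 + sqrt 2) + 1" "(1 - sqrt 2)\<^sup>2 = 2 * (1 - sqrt 2) + 1"
      by (simp_all add: power2_sum power2_diff)
    from this[THEN arg_cong[of _ _ complex_of_real]]
    have "?l\<^sup>2 = 2 * ?l + 1" "?l'\<^sup>2 = 2 * ?l' + 1"
      by (simp_all only: of_real_power of_real_add of_real_mult of_real_numeral of_real_1)
    note real = real[OF this(1) complex_cnj_complex_of_real] real[OF this(2) complex_cnj_complex_of_real]
    have imag: "?M *v E8_eigvec (c * \<i>) (- c) = p (c * \<i>) *s E8_eigvec (c * \<i>) (- c)"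
      "?M *v E8_eigvec (c * (- \<i>)) (- c) = p (c * (- \<i>)) *s E8_eigvec (c * (- \<i>)) (- c)"
      by (rule imag; simp)+
    show ?thesis
      unfolding u_def matrix_vector_right_distrib vector_scalar_commute real imag vector_smult_assoc ..
  qed
  have char_0: "zmod6_char c 0 = 1" for c
    by (simp add: zmod6_char_def bit0.Rep_0)
  have "hermitian_inner (?M *v axis (Vo 0) 1) (axis (Vo 0) 1) = (?M *v axis (Vo 0) 1) $ Vo 0"
    by (simp add: hermitian_inner_def axis_def if_distrib cong: if_cong)
  also have "\<dots> = (\<Sum>c\<in>cube_roots. (?M *v u c) $ Vo 0)"
    unfolding delta linear_sum[OF matrix_vector_mul_linear] by (rule sum_component)
  also have "\<dots> = (\<Sum>c\<in>cube_roots. ?a * p (c * ?l) + ?b * p (c * ?l') + 1 / 12 * p (c * \<i>)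
      + 1 / 12 * p (c * (- \<i>)))"
    by (rule sum.cong) (simp_all only: eig vector_add_component vector_smult_component
        E8_eigvec_simps char_0 mult_1_right)
  finally show ?thesis .
qed

subsection \<open>Integrals over unions of orbits\<close>

lemma borel_measurable_R [measurable]: "R m n \<in> borel_measurable torus_borel"
proof -
  have "(\<lambda>x :: complex \<times> complex. (fst x + inverse (snd x) + inverse (fst x) * snd x) ^ m
      * (inverse (fst x) + snd x + fst x * inverse (snd x)) ^ n) \<in> borel_measurable borel"
    unfolding borel_prod[symmetric] by measurable
  then show ?thesis
    unfolding R_def torus_borel_def case_prod_unfold by (rule measurable_restrict_space1)
qed

lemma sets_uniform_on [simp]: "sets (uniform_on S) = sets torus_borel"
  by (simp add: uniform_on_def)

text \<open>The identity pulls the integral back to a finite point measure on the full power set of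
  \<open>S\<close>, where integrals are finite sums.\<close>

lemma
  fixes f :: "complex \<times> complex \<Rightarrow> complex"
  assumes "finite S" "S \<subseteq> torus" "f \<in> borel_measurable torus_borel"
  shows integrable_uniform_on: "integrable (uniform_on S) f"
    and integral_uniform_on: "(\<integral>x. f x \<partial>uniform_on S) = (\<Sum>x\<in>S. f x) / card S"
proof -
  have id: "(\<lambda>x. x) \<in> uniform_count_measure S \<rightarrow>\<^sub>M torus_borel"
    using assms(2)
    by (auto simp: measurable_def space_uniform_count_measure sets_uniform_count_measure)
  show "integrable (uniform_on S) f"
    unfolding uniform_on_def integrable_distr_eq[OF id assms(3)]
    using assms(1) by (simp add: uniform_count_measure_def integrable_point_measure_finite)
  show "(\<integral>x. f x \<partial>uniform_on S) = (\<Sum>x\<in>S. f x) / card S"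
    unfolding uniform_on_def integral_distr[OF id assms(3)] using assms(1)
    by (simp add: uniform_count_measure_def lebesgue_integral_point_measure_finite
        scaleR_conv_of_real sum_divide_distrib)
qed

section \<open>Invariance of \<open>R\<close> and sizes of the orbits\<close>

lemma R_torus:
  assumes "x \<in> torus"
  shows "R m n x = R 1 0 x ^ m * cnj (R 1 0 x) ^ n"
proof -
  obtain a b where x: "x = (a, b)" by (cases x)
  have "cnj a = inverse a" "cnj b = inverse b"
    using assms unfolding x torus_iff by (auto intro: cnj_eq_inverse)
  then show ?thesis by (simp add: x R_def)
qed

text \<open>The group permutes the three numbers \<open>a\<close>, \<open>inverse b\<close> and
  \<open>inverse a * b\<close>, and with them their inverses. Their product is 1, so
  \<open>R 1 0\<close> is the trace of a diagonal matrix in SU(3).\<close>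

lemma R_S3_orbit:
  assumes x: "x \<in> torus" and y: "y \<in> S3_orbit x"
  shows "R m n y = R m n x"
proof -
  obtain a b where ab: "x = (a, b)" by (cases x)
  have "a \<noteq> 0" "b \<noteq> 0" using torus_nonzero[of a b] x ab by auto
  then have "fst y + inverse (snd y) + inverse (fst y) * snd y = a + inverse b + inverse a * b"
    "inverse (fst y) + snd y + fst y * inverse (snd y) = inverse a + b + a * inverse b"
    using y unfolding ab S3_orbit_eq[OF x[unfolded ab]] by (auto simp: field_simps)
  then show ?thesis by (simp add: R_def case_prod_unfold ab)
qed

text \<open>The three inequalities say that \<open>a\<close>, \<open>inverse b\<close> and
  \<open>inverse a * b\<close> are pairwise distinct, so their six orderings yield six different
  points.\<close>

lemma card_S3_orbit:
  assumes "(a, b) \<in> torus" "a * b \<noteq> 1" "a\<^sup>2 \<noteq> b" "b\<^sup>2 \<noteq> a"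
  shows "card (S3_orbit (a, b)) = 6"
proof -
  have nz: "a \<noteq> 0" "b \<noteq> 0" using torus_nonzero[OF assms(1)] by auto
  have "b \<noteq> a * a" "a \<noteq> b * b" using assms by (auto simp: power2_eq_square)
  moreover have "a \<noteq> inverse b" "b \<noteq> inverse a" "inverse a \<noteq> b" "inverse b \<noteq> a"
    using assms(2) nz by auto
  moreover have "inverse a * b \<noteq> a" "a * inverse b \<noteq> b"
    using calculation nz by (auto simp: field_simps)
  ultimately show ?thesis
    unfolding S3_orbit_eq[OF assms(1)] using nz
    by (simp add: card_insert_if) (auto simp: field_simps)
qed

text \<open>The relations make \<open>(v, w)\<close> a fixed point of the action: multiplying by it
  multiplies each of \<open>a\<close>, \<open>inverse b\<close> and \<open>inverse a * b\<close> by
  \<open>v\<close>, which keeps them distinct.\<close>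

lemma card_S3_orbit_shift:
  assumes "norm v = 1" "norm w = 1" "v * w = 1" "v\<^sup>2 = w" "w\<^sup>2 = v"
    and "(a, b) \<in> torus" "a * b \<noteq> 1" "a\<^sup>2 \<noteq> b" "b\<^sup>2 \<noteq> a"
  shows "card (S3_orbit (v * a, w * b)) = 6"
proof (rule card_S3_orbit)
  have "v \<noteq> 0" "w \<noteq> 0" using assms(3) by auto
  then show "(v * a)\<^sup>2 \<noteq> w * b" "(w * b)\<^sup>2 \<noteq> v * a"
    using assms(4,5,8,9) by (simp_all add: power_mult_distrib)
  have eq: "v * a * (w * b) = (v * w) * (a * b)" by (simp only: mult_ac)
  show "v * a * (w * b) \<noteq> 1" unfolding eq assms(3) using assms(7) by simp
  show "(v * a, w * b) \<in> torus" using assms(1,2,6) by (simp add: torus_iff norm_mult)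
qed

lemma omega_mult_cnj: "\<omega> * cnj \<omega> = 1" and omega_cnj_square: "(cnj \<omega>)\<^sup>2 = \<omega>"
  using omega_facts(1,2) by algebra+

text \<open>For \<open>(T * K, T)\<close> the three numbers to be distinguished are
  \<open>T * K\<close>, \<open>cnj T\<close> and \<open>cnj K\<close>, and the inequalities say that
  they differ. Up to a common cube root of unity, each other point leads to these numbers or to
  their conjugates.\<close>

lemma card_S3_orbit_pair:
  assumes "norm T = 1" "norm K = 1" "T\<^sup>2 * K \<noteq> 1" "T * K\<^sup>2 \<noteq> 1" "T \<noteq> K"
    and "x \<in> {(T * K, T), (T, T * K), (cnj \<omega> * cnj T, \<omega> * K), (\<omega> * K, cnj \<omega> * cnj T),
      (cnj \<omega> * cnj T * cnj K, \<omega> * cnj K), (\<omega> * cnj K, cnj \<omega> * cnj T * cnj K)}"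
  shows "card (S3_orbit x) = 6"
proof -
  have nz: "T \<noteq> 0" "K \<noteq> 0" using assms(1,2) by auto
  have cnj: "cnj T = inverse T" "cnj K = inverse K"
    using assms(1,2) by (auto intro: cnj_eq_inverse)
  have 1: "card (S3_orbit (T * K, T)) = 6" "card (S3_orbit (T, T * K)) = 6"
    using assms(1-5) nz
    by (auto intro!: card_S3_orbit simp: torus_iff norm_mult field_simps power2_eq_square)
  have w: "card (S3_orbit (cnj \<omega> * a, \<omega> * b)) = 6" "card (S3_orbit (\<omega> * b, cnj \<omega> * a)) = 6"
    if "norm a = 1" "norm b = 1" "a * b \<noteq> 1" "a\<^sup>2 \<noteq> b" "b\<^sup>2 \<noteq> a" for a b
  proof -
    have t: "(a, b) \<in> torus" "(b, a) \<in> torus" using that(1,2) by (simp_all add: torus_iff)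
    have n: "norm (cnj \<omega>) = 1" unfolding complex_mod_cnj by (rule norm_expi)
    show "card (S3_orbit (cnj \<omega> * a, \<omega> * b)) = 6"
      by (rule card_S3_orbit_shift[OF n norm_expi _ omega_cnj_square omega_facts(2)[symmetric] t(1) that(3-5)])
        (subst mult.commute, rule omega_mult_cnj)
    show "card (S3_orbit (\<omega> * b, cnj \<omega> * a)) = 6"
      by (rule card_S3_orbit_shift[OF norm_expi n omega_mult_cnj omega_facts(2)[symmetric] omega_cnj_square
          t(2) _ that(5,4)]) (subst mult.commute, rule that(3))
  qed
  have "cnj T * K \<noteq> 1" "(cnj T)\<^sup>2 \<noteq> K" "K\<^sup>2 \<noteq> cnj T"
    and "cnj T * cnj K * cnj K \<noteq> 1" "(cnj T * cnj K)\<^sup>2 \<noteq> cnj K" "(cnj K)\<^sup>2 \<noteq> cnj T * cnj K"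
    using assms(3-5) nz by (auto simp: cnj field_simps power2_eq_square)
  then have "card (S3_orbit (cnj \<omega> * cnj T, \<omega> * K)) = 6" "card (S3_orbit (\<omega> * K, cnj \<omega> * cnj T)) = 6"
    "card (S3_orbit (cnj \<omega> * (cnj T * cnj K), \<omega> * cnj K)) = 6"
    "card (S3_orbit (\<omega> * cnj K, cnj \<omega> * (cnj T * cnj K))) = 6"
    by (intro w; simp add: norm_mult assms(1,2) mult.assoc[symmetric])+
  with 1 show ?thesis
    using assms(6) unfolding insert_iff empty_iff mult.assoc by metis
qed

text \<open>\<open>R 1 0\<close> is constant on orbits, so its injectivity on the representatives
  makes the orbits disjoint; the common orbit size 6 then cancels against the size of the
  union.\<close>

lemma integral_uniform_on_orbits:
  assumes "finite X" and torus: "X \<subseteq> torus" and inj: "inj_on (R 1 0) X"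
    and card: "\<And>x. x \<in> X \<Longrightarrow> card (S3_orbit x) = 6"
  shows "(\<integral>x. R m n x \<partial>uniform_on (\<Union>x\<in>X. S3_orbit x)) =
    (\<Sum>t\<in>R 1 0 ` X. t ^ m * cnj t ^ n) / card X"
proof -
  have fin: "finite (S3_orbit x)" if "x \<in> X" for x using that torus S3_orbit_finite by blast
  have sub: "(\<Union>x\<in>X. S3_orbit x) \<subseteq> torus" using torus S3_orbit_subset by blast
  have disj: "S3_orbit x \<inter> S3_orbit y = {}" if "x \<in> X" "y \<in> X" "x \<noteq> y" for x y
  proof (rule ccontr)
    assume "S3_orbit x \<inter> S3_orbit y \<noteq> {}"
    then obtain z where "z \<in> S3_orbit x" "z \<in> S3_orbit y" by blast
    then have "R 1 0 x = R 1 0 y" using R_S3_orbit that torus by (metis subsetD)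
    then show False using inj that by (auto dest: inj_onD)
  qed
  have "(\<Sum>z\<in>(\<Union>x\<in>X. S3_orbit x). R m n z) = (\<Sum>x\<in>X. \<Sum>z\<in>S3_orbit x. R m n z)"
    using assms(1) fin disj by (intro sum.UNION_disjoint) auto
  also have "\<dots> = (\<Sum>x\<in>X. 6 * R m n x)"
  proof (rule sum.cong)
    fix x assume x: "x \<in> X"
    then have "(\<Sum>z\<in>S3_orbit x. R m n z) = (\<Sum>z\<in>S3_orbit x. R m n x)"
      using torus by (intro sum.cong R_S3_orbit) auto
    then show "(\<Sum>z\<in>S3_orbit x. R m n z) = 6 * R m n x" using card[OF x] by simp
  qed simp
  also have "\<dots> = 6 * (\<Sum>t\<in>R 1 0 ` X. t ^ m * cnj t ^ n)"
    unfolding sum_distrib_left sum.reindex[OF inj]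
    using torus by (intro sum.cong) (auto simp: R_torus[of _ m n])
  finally have s: "(\<Sum>z\<in>(\<Union>x\<in>X. S3_orbit x). R m n z) =
    6 * (\<Sum>t\<in>R 1 0 ` X. t ^ m * cnj t ^ n)" .
  have "card (\<Union>x\<in>X. S3_orbit x) = (\<Sum>x\<in>X. card (S3_orbit x))"
    using assms(1) fin disj by (intro card_UN_disjoint) auto
  then have "card (\<Union>x\<in>X. S3_orbit x) = 6 * card X" using card by simp
  then show ?thesis
    using assms(1) fin sub by (subst integral_uniform_on) (auto simp: s simp del: split_paired_All)
qed

section \<open>Integrals against the two families of measures\<close>

lemma R_1_0: "R 1 0 (a, b) = a + inverse b + inverse a * b"
  by (simp add: R_def)

text \<open>The traces at the three representatives are \<open>t\<close>,
  \<open>cnj \<omega> * t\<close> and \<open>\<omega> * t\<close>, which are distinct because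
  \<open>t\<close> is nonzero.\<close>

lemma integral_d_diag:
  assumes "\<tau> s ^ 2 \<noteq> 1" and t: "t = 1 + \<tau> s + cnj (\<tau> s)" "t \<noteq> 0"
  shows "(\<integral>x. R m n x \<partial>d_diag s) = (\<Sum>c\<in>cube_roots. (c * t) ^ m * cnj (c * t) ^ n) / 3"
proof -
  define T w where "T = \<tau> s" and "w = \<omega>"
  let ?X = "{(T, T), (cnj w * cnj T, w), (w, cnj w * cnj T)}"
  have norm: "norm T = 1" "norm w = 1" unfolding T_def w_def by (rule norm_expi)+
  have TT: "T * cnj T = 1" "w * cnj w = 1" using norm by (simp_all add: complex_norm_square[symmetric])
  then have inv: "inverse T = cnj T" "inverse w = cnj w" "inverse (cnj T) = T" "inverse (cnj w) = w"
    by (simp_all add: inverse_unique mult.commute)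
  have w: "w ^ 3 = 1" "cnj w = w\<^sup>2" "1 + w + cnj w = 0" "w \<noteq> 1" "w \<noteq> cnj w" "cnj w \<noteq> 1"
    unfolding w_def by (rule omega_facts)+
  have T: "T\<^sup>2 \<noteq> 1" "T \<noteq> 1" "t = 1 + T + cnj T" using assms(1) t by (auto simp: T_def)
  have R: "R 1 0 (T, T) = t" "R 1 0 (cnj w * cnj T, w) = cnj w * t" "R 1 0 (w, cnj w * cnj T) = w * t"
    unfolding R_1_0 inverse_mult_distrib inv T(3) using TT w(1,2) by algebra+
  have ne: "cnj w * t \<noteq> t" "w * t \<noteq> t" "w * t \<noteq> cnj w * t" using w t(2) by auto
  have injw: "inj_on (\<lambda>c. c * t) {1, w, cnj w}" using t(2) by (auto simp: inj_on_def)
  have inj: "inj_on (R 1 0) ?X"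
    using ne by (auto simp: R inj_on_def simp del: One_nat_def)
  \<comment> \<open>With \<open>K = 1\<close> the three inequalities reduce to
    \<open>T\<^sup>2 \<noteq> 1\<close> and \<open>T \<noteq> 1\<close>.\<close>
  have "card (S3_orbit x) = 6" if "x \<in> ?X" for x
    using that T(1,2) norm by (intro card_S3_orbit_pair[where T = T and K = 1]) (auto simp: w_def)
  moreover have "?X \<subseteq> torus" using norm by (auto simp: torus_iff norm_mult)
  ultimately have "(\<integral>x. R m n x \<partial>uniform_on (\<Union>x\<in>?X. S3_orbit x)) =
      (\<Sum>t\<in>R 1 0 ` ?X. t ^ m * cnj t ^ n) / card (R 1 0 ` ?X)"
    using inj unfolding card_image[OF inj] by (intro integral_uniform_on_orbits) auto
  also have "R 1 0 ` ?X = (\<lambda>c. c * t) ` {1, w, cnj w}"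
    unfolding image_insert R image_empty by auto
  also have "card \<dots> = 3"
    using w injw by (subst card_image) auto
  also have "(\<Union>x\<in>?X. S3_orbit x) = d_diag_points s"
    unfolding d_diag_points_def T_def w_def by auto
  finally show ?thesis
    unfolding sum.reindex[OF injw] comp_def unfolding d_diag_def w_def of_nat_numeral .
qed

text \<open>The six representatives form two triples, whose traces are the multiples of
  \<open>t\<close> and of \<open>cnj t\<close> by cube roots of unity. Such multiples keep the cube,
  so the hypothesis on cubes separates the triples; it also excludes \<open>t = 0\<close>.\<close>

lemma integral_d_pair:
  assumes "\<tau> s ^ 2 * expi k \<noteq> 1" "\<tau> s * expi k ^ 2 \<noteq> 1" "\<tau> s \<noteq> expi k"
    and t: "t = \<tau> s * expi k + cnj (\<tau> s) + cnj (expi k)" "t ^ 3 \<noteq> cnj t ^ 3"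
  shows "(\<integral>x. R m n x \<partial>d_pair s k) =
    ((\<Sum>c\<in>cube_roots. (c * t) ^ m * cnj (c * t) ^ n) +
     (\<Sum>c\<in>cube_roots. (c * cnj t) ^ m * cnj (c * cnj t) ^ n)) / 6"
proof -
  define T w K where "T = \<tau> s" and "w = \<omega>" and "K = expi k"
  let ?A = "{(T * K, T), (cnj w * cnj T, w * K), (w * cnj K, cnj w * cnj T * cnj K)}"
  let ?B = "{(T, T * K), (w * K, cnj w * cnj T), (cnj w * cnj T * cnj K, w * cnj K)}"
  let ?X = "?A \<union> ?B"
  have norm: "norm T = 1" "norm w = 1" "norm K = 1" unfolding T_def w_def K_def by (rule norm_expi)+
  have TT: "T * cnj T = 1" "w * cnj w = 1" "K * cnj K = 1"
    using norm by (simp_all add: complex_norm_square[symmetric])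
  then have inv: "inverse T = cnj T" "inverse w = cnj w" "inverse K = cnj K"
      "inverse (cnj T) = T" "inverse (cnj w) = w" "inverse (cnj K) = K"
    by (simp_all add: inverse_unique mult.commute)
  have w: "w ^ 3 = 1" "cnj w = w\<^sup>2" "1 + w + cnj w = 0" "w \<noteq> 1" "w \<noteq> cnj w" "cnj w \<noteq> 1"
    unfolding w_def by (rule omega_facts)+
  have cw3: "cnj w ^ 3 = 1" using w(1,2) by algebra
  have T: "T\<^sup>2 * K \<noteq> 1" "T * K\<^sup>2 \<noteq> 1" "T \<noteq> K" "t = T * K + cnj T + cnj K"
    using assms(1-3) t(1) by (auto simp: T_def K_def)
  then have T': "cnj t = cnj T * cnj K + T + K" by simp
  have RA: "R 1 0 (T * K, T) = t" "R 1 0 (cnj w * cnj T, w * K) = cnj w * t"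
    "R 1 0 (w * cnj K, cnj w * cnj T * cnj K) = w * t"
    unfolding R_1_0 inverse_mult_distrib inv T(4) using TT w(1,2) by algebra+
  have RB: "R 1 0 (T, T * K) = cnj t" "R 1 0 (w * K, cnj w * cnj T) = w * cnj t"
    "R 1 0 (cnj w * cnj T * cnj K, w * cnj K) = cnj w * cnj t"
    unfolding R_1_0 inverse_mult_distrib inv T' using TT w(1,2) by algebra+
  have t0: "t \<noteq> 0" "cnj t \<noteq> 0" using t(2) by auto
  have ne: "c * t \<noteq> d * cnj t" if "c \<in> {1, w, cnj w}" "d \<in> {1, w, cnj w}" for c d
  proof
    assume "c * t = d * cnj t"
    then have "c ^ 3 * t ^ 3 = d ^ 3 * cnj t ^ 3" by (simp flip: power_mult_distrib)
    moreover have "c ^ 3 = 1" "d ^ 3 = 1" using that w(1) cw3 by auto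
    ultimately show False using t(2) by simp
  qed
  have imA: "R 1 0 ` ?A = (\<lambda>c. c * t) ` {1, w, cnj w}"
    and imB: "R 1 0 ` ?B = (\<lambda>c. c * cnj t) ` {1, w, cnj w}"
    unfolding image_insert RA RB image_empty by auto
  have injw: "inj_on (\<lambda>c. c * t) {1, w, cnj w}" "inj_on (\<lambda>c. c * cnj t) {1, w, cnj w}"
    using t0 by (auto simp: inj_on_def)
  have card3: "card {1, w, cnj w} = 3" using w by auto
  have disj: "(\<lambda>c. c * t) ` {1, w, cnj w} \<inter> (\<lambda>c. c * cnj t) ` {1, w, cnj w} = {}"
    using ne by blast
  have im: "R 1 0 ` ?X = (\<lambda>c. c * t) ` {1, w, cnj w} \<union> (\<lambda>c. c * cnj t) ` {1, w, cnj w}"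
    unfolding image_Un imA imB ..
  have card6: "card (R 1 0 ` ?X) = 6"
  proof -
    have "finite ((\<lambda>c. c * t) ` {1, w, cnj w})" "finite ((\<lambda>c. c * cnj t) ` {1, w, cnj w})"
      by simp_all
    from card_Un_disjoint[OF this disj] show ?thesis
      unfolding im card_image[OF injw(1)] card_image[OF injw(2)] card3 by simp
  qed
  \<comment> \<open>Injectivity comes from counting: the trace takes six values on at most six
    points.\<close>
  have "card ?X \<le> 6"
  proof -
    have "card (set [x1, x2, x3, x4, x5, x6]) \<le> 6" for x1 x2 x3 x4 x5 x6 :: "complex \<times> complex"
      by (rule order_trans[OF card_length]) simp
    then show ?thesis by (simp only: list.set Un_insert_left Un_empty_left)
  qed
  moreover have "card (R 1 0 ` ?X) \<le> card ?X" by (rule card_image_le) simp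
  ultimately have inj: "inj_on (R 1 0) ?X"
    using card6 by (intro eq_card_imp_inj_on) simp_all
  have "card (S3_orbit x) = 6" if "x \<in> ?X" for x
    using that[unfolded w_def] by (intro card_S3_orbit_pair[OF norm(1,3) T(1-3)]) blast
  moreover have "?X \<subseteq> torus" using norm by (auto simp: torus_iff norm_mult)
  ultimately have "(\<integral>x. R m n x \<partial>uniform_on (\<Union>x\<in>?X. S3_orbit x)) =
      (\<Sum>t\<in>R 1 0 ` ?X. t ^ m * cnj t ^ n) / card (R 1 0 ` ?X)"
    using inj unfolding card_image[OF inj] by (intro integral_uniform_on_orbits) auto
  also have "\<dots> = ((\<Sum>t\<in>(\<lambda>c. c * t) ` {1, w, cnj w}. t ^ m * cnj t ^ n)
      + (\<Sum>t\<in>(\<lambda>c. c * cnj t) ` {1, w, cnj w}. t ^ m * cnj t ^ n)) / 6"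
    unfolding card6 unfolding im by (subst sum.union_disjoint[OF _ _ disj]) simp_all
  also have "(\<Union>x\<in>?X. S3_orbit x) = d_pair_points s k"
    unfolding d_pair_points_def cnj_expi[symmetric] T_def w_def K_def by auto
  finally show ?thesis
    unfolding sum.reindex[OF injw(1)] sum.reindex[OF injw(2)] comp_def
    unfolding d_pair_def w_def .
qed

subsection \<open>The three measures\<close>

lemma sum_cube_roots_shift: "(\<Sum>c\<in>cube_roots. f (c * \<omega>)) = (\<Sum>c\<in>cube_roots. f c)"
  and sum_cube_roots_shift_cnj: "(\<Sum>c\<in>cube_roots. f (c * cnj \<omega>)) = (\<Sum>c\<in>cube_roots. f c)"
proof -
  have m: "\<omega> * \<omega> = cnj \<omega>" "cnj \<omega> * cnj \<omega> = \<omega>" "\<omega> * cnj \<omega> = 1" "cnj \<omega> * \<omega> = 1"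
    using omega_facts(2) omega_cnj_square omega_mult_cnj by (metis power2_eq_square mult.commute)+
  show "(\<Sum>c\<in>cube_roots. f (c * \<omega>)) = (\<Sum>c\<in>cube_roots. f c)"
    "(\<Sum>c\<in>cube_roots. f (c * cnj \<omega>)) = (\<Sum>c\<in>cube_roots. f c)"
    unfolding sum_cube_roots m mult_1_left by (simp_all only: add_ac)
qed

lemma cis_pi_minus: "cis (pi - a) = - cis (- a)"
  by (simp add: complex_eq_iff)

lemma tau_cis: "\<tau> s = cis (2 * pi / of_rat s)"
  unfolding expi_cis by simp

text \<open>The trace is \<open>1 + 2 * cos (pi / 4)\<close>.\<close>

lemma integral_d_diag_8:
  "(\<integral>x. R m n x \<partial>d_diag 8) =
    (\<Sum>c\<in>cube_roots. (c * of_real (1 + sqrt 2)) ^ m * cnj (c * of_real (1 + sqrt 2)) ^ n) / 3"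
proof (rule integral_d_diag)
  have \<tau>: "\<tau> 8 = cis (pi / 4)" unfolding tau_cis by simp
  have "cis (pi / 4) ^ 2 = \<i>" by (simp add: Complex.DeMoivre)
  then show "\<tau> 8 ^ 2 \<noteq> 1" unfolding \<tau> by simp
  show "complex_of_real (1 + sqrt 2) = 1 + \<tau> 8 + cnj (\<tau> 8)"
    unfolding \<tau> by (simp add: complex_eq_iff cos_45)
  show "complex_of_real (1 + sqrt 2) \<noteq> 0"
    unfolding of_real_eq_0_iff by (smt (verit) real_sqrt_ge_zero)
qed

text \<open>The angle is now \<open>3 * pi / 4\<close>, the supplement of \<open>pi / 4\<close>, so
  the cosine changes sign.\<close>

lemma integral_d_diag_8_3:
  "(\<integral>x. R m n x \<partial>d_diag (8 / 3)) =
    (\<Sum>c\<in>cube_roots. (c * of_real (1 - sqrt 2)) ^ m * cnj (c * of_real (1 - sqrt 2)) ^ n) / 3"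
proof (rule integral_d_diag)
  have arg: "2 * pi / of_rat (8 / 3) = pi - pi / 4" by (simp add: of_rat_divide)
  have \<tau>: "\<tau> (8 / 3) = - cis (- (pi / 4))"
    unfolding tau_cis arg by (rule cis_pi_minus)
  have "cis (- (pi / 4)) ^ 2 = cis (- (pi / 2))" by (simp add: Complex.DeMoivre)
  then have "\<tau> (8 / 3) ^ 2 = - \<i>" unfolding \<tau> by (simp add: complex_eq_iff)
  then show "\<tau> (8 / 3) ^ 2 \<noteq> 1" by (simp only:) (simp add: complex_eq_iff)
  show "complex_of_real (1 - sqrt 2) = 1 + \<tau> (8 / 3) + cnj (\<tau> (8 / 3))"
    unfolding \<tau> by (simp add: complex_eq_iff cos_45)
  show "complex_of_real (1 - sqrt 2) \<noteq> 0"
    unfolding of_real_eq_0_iff by simp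
qed

lemma integral_d_pair_24_5:
  "(\<integral>x. R m n x \<partial>d_pair (24 / 5) (1 / 12)) =
    ((\<Sum>c\<in>cube_roots. (c * \<i>) ^ m * cnj (c * \<i>) ^ n) +
     (\<Sum>c\<in>cube_roots. (c * (- \<i>)) ^ m * cnj (c * (- \<i>)) ^ n)) / 6"
proof -
  define T K where "T = \<tau> (24 / 5)" and "K = expi (1 / 12)"
  have arg: "2 * pi / of_rat (24 / 5) = 5 * pi / 12" by (simp add: of_rat_divide)
  have T: "T = cis (5 * pi / 12)" unfolding T_def tau_cis arg ..
  have K: "K = cis (pi / 6)" unfolding K_def expi_cis by simp
  have TTK: "T\<^sup>2 * K = - 1" by (simp add: T K Complex.DeMoivre cis_mult)
  \<comment> \<open>The angle of \<open>T * K\<^sup>2\<close> is \<open>3 * pi / 4\<close>; a fourth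
    power different from 1 rules out the value 1.\<close>
  have "(T * K\<^sup>2) ^ 4 = cis (2 * pi + pi)" by (simp add: T K Complex.DeMoivre cis_mult)
  also have "\<dots> = - 1" by (simp add: complex_eq_iff)
  finally have TKK: "(T * K\<^sup>2) ^ 4 = - 1" .
  have K3: "K ^ 3 = \<i>" by (simp add: K Complex.DeMoivre)
  \<comment> \<open>As \<open>7 * pi / 12 = pi - 5 * pi / 12\<close>, the summands
    \<open>T * K\<close> and \<open>cnj T\<close> of the trace cancel and \<open>cnj K\<close>
    remains.\<close>
  have "T * K = cis (pi - 5 * pi / 12)" by (simp add: T K cis_mult)
  also have "\<dots> = - cnj T" unfolding T cis_cnj by (rule cis_pi_minus)
  finally have TK: "T * K = - cnj T" .
  \<comment> \<open>\<open>cnj K\<close> differs from \<open>\<i>\<close> by a cube root of unity,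
    so both have the same multiples by such roots; this turns the traces into the eigenvalues of the
    graph.\<close>
  have "cnj \<omega> * \<i> = cis (- (2 * pi / 3)) * cis (pi / 2)"
    unfolding expi_cis by (simp add: cis_cnj)
  also have "\<dots> = cis (- (pi / 6))" unfolding cis_mult by (rule arg_cong[where f = cis]) simp
  finally have t: "cnj K = cnj \<omega> * \<i>" by (simp only: K cis_cnj)
  have t': "K = \<omega> * (- \<i>)" using arg_cong[OF t, of cnj] by (simp only: complex_cnj_mult complex_cnj_cnj complex_cnj_i)
  have ne: "T\<^sup>2 * K \<noteq> 1" "T * K\<^sup>2 \<noteq> 1" unfolding TTK using TKK by auto
  have TK_ne: "T \<noteq> K"
  proof
    assume "T = K"
    then have "K ^ 3 = - 1" using TTK by (simp add: power2_eq_square power3_eq_cube)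
    then show False unfolding K3 by (simp add: complex_eq_iff)
  qed
  have trace: "cnj K = T * K + cnj T + cnj K" unfolding TK by simp
  have cube: "cnj K ^ 3 \<noteq> cnj (cnj K) ^ 3"
    unfolding complex_cnj_power[symmetric] K3 by (simp add: complex_eq_iff)
  have "(\<integral>x. R m n x \<partial>d_pair (24 / 5) (1 / 12)) =
    ((\<Sum>c\<in>cube_roots. (c * cnj K) ^ m * cnj (c * cnj K) ^ n) +
     (\<Sum>c\<in>cube_roots. (c * cnj (cnj K)) ^ m * cnj (c * cnj (cnj K)) ^ n)) / 6"
    by (rule integral_d_pair[of "24 / 5" "1 / 12", folded T_def K_def, OF ne TK_ne trace cube])
  also have "(\<Sum>c\<in>cube_roots. (c * cnj K) ^ m * cnj (c * cnj K) ^ n) =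
      (\<Sum>c\<in>cube_roots. (c * \<i>) ^ m * cnj (c * \<i>) ^ n)"
    using sum_cube_roots_shift_cnj[of "\<lambda>c. (c * \<i>) ^ m * cnj (c * \<i>) ^ n"]
    unfolding t mult.assoc .
  also have "(\<Sum>c\<in>cube_roots. (c * cnj (cnj K)) ^ m * cnj (c * cnj (cnj K)) ^ n) =
      (\<Sum>c\<in>cube_roots. (c * (- \<i>)) ^ m * cnj (c * (- \<i>)) ^ n)"
    using sum_cube_roots_shift[of "\<lambda>c. (c * (- \<i>)) ^ m * cnj (c * (- \<i>)) ^ n"]
    unfolding complex_cnj_cnj t' mult.assoc .
  finally show ?thesis .
qed

theorem theorem2p3:
  shows "is_spectral_measure E8 (Vo 0)
    (add_measure
      (add_measure
        (scale_measure (ennreal ((2 - sqrt 2) / 8)) (d_diag 8))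
        (scale_measure (ennreal ((2 + sqrt 2) / 8)) (d_diag (8 / 3))))
      (scale_measure (ennreal (1 / 2)) (d_pair (24 / 5) (1 / 12))))"
    (is "is_spectral_measure _ _ (add_measure (add_measure ?M1 ?M2) ?M3)")
proof -
  have sets: "sets ?M1 = sets ?M2" "sets (add_measure ?M1 ?M2) = sets ?M3"
    "sets (add_measure ?M1 ?M2) = sets torus_borel"
    by (simp_all add: d_diag_def d_pair_def)
  \<comment> \<open>Nonnegativity matters because \<open>ennreal\<close> sends negative reals to
    0.\<close>
  have "sqrt 2 \<le> 2" by (rule real_le_lsqrt) simp_all
  then have pos: "0 \<le> (2 - sqrt 2) / 8" "0 \<le> (2 + sqrt 2) / 8" "0 \<le> (1 / 2 :: real)"
    by (simp_all add: add_nonneg_nonneg)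
  have int: "integrable (d_diag s) (R m n)" "integrable (d_pair s k) (R m n)" for m n s k
    unfolding d_diag_def d_pair_def
    by (intro integrable_uniform_on borel_measurable_R d_diag_points d_pair_points)+
  have i: "integrable ?M1 (R m n)" "integrable ?M2 (R m n)" "integrable ?M3 (R m n)" for m n
    by (intro integrable_scale_measure int pos)+
  have i12: "integrable (add_measure ?M1 ?M2) (R m n)" for m n
    by (intro integrable_add_measure sets i)
  have "(\<integral>x. R m n x \<partial>add_measure (add_measure ?M1 ?M2) ?M3) =
      hermitian_inner ((matrix_power (adjacency_matrix E8) m **
        matrix_power (adjoint_matrix (adjacency_matrix E8)) n) *v axis (Vo 0) 1) (axis (Vo 0) 1)"
    for m n
  proof -
    define S where "S x = (\<Sum>c\<in>cube_roots. (c * x) ^ m * cnj (c * x) ^ n)" for x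
    have "(\<integral>x. R m n x \<partial>add_measure (add_measure ?M1 ?M2) ?M3) =
        of_real ((2 - sqrt 2) / 8) * (S (of_real (1 + sqrt 2)) / 3) +
        of_real ((2 + sqrt 2) / 8) * (S (of_real (1 - sqrt 2)) / 3) +
        of_real (1 / 2) * ((S \<i> + S (- \<i>)) / 6)"
      unfolding integral_add_measure[OF sets(2) i12 i(3)] integral_add_measure[OF sets(1) i(1,2)]
        integral_scale_measure[OF int(1) pos(1)] integral_scale_measure[OF int(1) pos(2)]
        integral_scale_measure[OF int(2) pos(3)] integral_d_diag_8 integral_d_diag_8_3
        integral_d_pair_24_5 scaleR_conv_of_real S_def ..
    \<comment> \<open>The factors 1/3 and 1/6 of the uniform measures turn the denominators 8 and 2
      into the 24 and 12 of the eigenvector expansion.\<close>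
    also have "\<dots> = of_real ((2 - sqrt 2) / 24) * S (of_real (1 + sqrt 2)) +
        of_real ((2 + sqrt 2) / 24) * S (of_real (1 - sqrt 2)) + 1 / 12 * S \<i> + 1 / 12 * S (- \<i>)"
      by (simp add: add_divide_distrib)
    finally show ?thesis
      unfolding E8_moments sum.distrib sum_distrib_left[symmetric] S_def .
  qed
  moreover have "verts E8 = UNIV" by (simp add: E8_def)
  moreover have "space (add_measure (add_measure ?M1 ?M2) ?M3) = torus"
    using sets_eq_imp_space_eq[OF sets(3)] by simp
  moreover have "integrable (add_measure (add_measure ?M1 ?M2) ?M3) (R m n)" for m n
    by (intro integrable_add_measure sets i i12)
  ultimately show ?thesis
    unfolding is_spectral_measure_def Let_def sets_add_measure sets(3)[unfolded sets_add_measure]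
    using fin_digraph_E8 E8_normal by blast
qed

end
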